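(* Let $g,m_0,m_1$ be positive integers and let $k=jg+1$ with $j\in\mathbb Z$. The linear function $r(t)=kt$ is a solution of the $(g,m_0,m_1,k)$-boundary value problem if and only if $k=1$, or ($g=2$ and $k=-1$), or ($m_0=m_1$ and $k=1-g$).
   Context: The $(g,m_0,m_1,k)$-boundary value problem is $$\begin{aligned}0={}&4\sin^2 gt\cdot\ddot r(t)+\bigl(g(m_0+m_1)\sin 2gt+2g(m_0-m_1)\sin gt\bigr)\dot r(t)\\&-g(g-2)\sin 2(r(t)-t)\,\bigl(m_0+m_1+(m_0-m_1)\cos gt\bigr)\\&-2g\sin\bigl(2(r(t)-t)+gt\bigr)\,\bigl((m_0+m_1)\cos gt+m_0-m_1\bigr)\end{aligned}$$ for functions $r:\,]0,\frac{\pi}{g}[\,\to\mathbb R$ with $\lim_{t\to0}r(t)=0$ and $\lim_{t\to\pi/g}r(t)=k\frac{\pi}{g}$.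
   Formalization: The case g=1, m_0=m_1, k=-1 is excluded: there r(t)=-t does solve the boundary value problem although none of the three listed conditions holds, so the equivalence as stated fails exactly in that case. *)

theory Defs
  imports "HOL-Analysis.Analysis"
begin

(* Right-hand side of the ODE at time t; r, r1, r2 stand for the values of the unknown function
   and of its first and second derivative at t. *)
definition bvp_rhs :: "nat \<Rightarrow> nat \<Rightarrow> nat \<Rightarrow> real \<Rightarrow> real \<Rightarrow> real \<Rightarrow> real \<Rightarrow> real" where
  "bvp_rhs g m0 m1 t r r1 r2 =
     4 * (sin (real g * t))\<^sup>2 * r2
     + (real g * (real m0 + real m1) * sin (2 * real g * t)
        + 2 * real g * (real m0 - real m1) * sin (real g * t)) * r1
     - real g * (real g - 2) * sin (2 * (r - t))
        * (real m0 + real m1 + (real m0 - real m1) * cos (real g * t))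
     - 2 * real g * sin (2 * (r - t) + real g * t)
        * ((real m0 + real m1) * cos (real g * t) + real m0 - real m1)"

(* Functions on the open interval ]0, pi/g[ are represented by total functions on the reals;
   all conditions only look at the values of r on that interval. *)
definition solves_bvp :: "nat \<Rightarrow> nat \<Rightarrow> nat \<Rightarrow> int \<Rightarrow> (real \<Rightarrow> real) \<Rightarrow> bool" where
  "solves_bvp g m0 m1 k r \<longleftrightarrow>
     (\<exists>r' r''. \<forall>t\<in>{0<..<pi / real g}.
        (r has_real_derivative r' t) (at t) \<and>
        (r' has_real_derivative r'' t) (at t) \<and>
        0 = bvp_rhs g m0 m1 t (r t) (r' t) (r'' t)) \<and>
     (r \<longlongrightarrow> 0) (at_right 0) \<and>
     (r \<longlongrightarrow> of_int k * (pi / real g)) (at_left (pi / real g))"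

(* For g = 1 and m0 = m1 the reflection t |-> -t is a further linear solution, with
   k = -1 = (-2) * g + 1.  It is not covered by the three families k = 1, (g = 2, k = -1) and
   (m0 = m1, k = 1 - g), so a classification by these three families has to exclude it. *)
lemma solves_bvp_reflection: "solves_bvp 1 m m (- 1) (\<lambda>t. of_int (- 1) * t)"
proof -
  have "0 = bvp_rhs 1 m m t (- t) (- 1) 0" for t
  proof -
    have p: "2 * (sin (3 * t) * cos t) = sin (4 * t) + sin (2 * t)"
      using sin_add[of "3 * t" t] sin_diff[of "3 * t" t] by simp
    have "sin (2 * (- t - t)) = - sin (4 * t)" "sin (2 * (- t - t) + t) = - sin (3 * t)"
      using sin_minus[of "4 * t"] sin_minus[of "3 * t"] by simp_all
    then have "bvp_rhs 1 m m t (- t) (- 1) 0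
        = 2 * real m * (2 * (sin (3 * t) * cos t) - (sin (4 * t) + sin (2 * t)))"
      unfolding bvp_rhs_def by (simp only:) (simp add: algebra_simps)
    then show ?thesis
      unfolding p by simp
  qed
  then show ?thesis
    unfolding solves_bvp_def
    by (intro conjI exI[of _ "\<lambda>_. - 1"] exI[of _ "\<lambda>_. 0"])
       (auto intro!: derivative_eq_intros tendsto_eq_intros)
qed

end

theory Submission
  imports Defs
begin

text \<open>
  For \<open>r t = k * t\<close> with \<open>k = j * g + 1\<close> and \<open>x = g * t\<close>, product-to-sum formulas turn the
  right-hand side into a linear combination of sines of integer multiples of \<open>x\<close>. Those of even
  frequency carry the factor \<open>m0 + m1\<close>, those of odd frequency the factor \<open>m0 - m1\<close>, and the
  substitution of \<open>pi - x\<close> for \<open>x\<close> separates the two. The third derivative of the even part at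
  \<open>0\<close> gives \<open>k = (g - 1) * j^3 + (j + 1)^3\<close>, which leaves only \<open>j = 0\<close>, \<open>j = -1\<close> and
  \<open>g = 1, j = -2\<close>. Evaluation at \<open>x = pi / 2\<close>, where the even part vanishes, gives \<open>m0 = m1\<close> or
  \<open>k = (-1)^j\<close>.
\<close>

text \<open>The argument is \<open>y = 2 * x\<close>, so the even frequencies appear here halved, as
  \<open>1\<close>, \<open>j\<close> and \<open>j + 1\<close>.\<close>

definition even_part :: "real \<Rightarrow> real \<Rightarrow> real \<Rightarrow> real \<Rightarrow> real" where
  "even_part g k j y = k * sin y - (g - 1) * sin (j * y) - sin ((j + 1) * y)"

definition odd_part :: "real \<Rightarrow> real \<Rightarrow> real \<Rightarrow> real \<Rightarrow> real" where
  "odd_part g k j x = 2 * k * sin x - (g + 2) / 2 * sin ((2 * j + 1) * x)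
     - (g - 2) / 2 * sin ((2 * j - 1) * x)"

lemma bvp_rhs_linear:
  fixes j k :: real
  assumes "k = j * real g + 1"
  shows "bvp_rhs g m0 m1 t (k * t) k 0 = real g *
    ((real m0 + real m1) * even_part (real g) k j (2 * (real g * t))
     + (real m0 - real m1) * odd_part (real g) k j (real g * t))"
proof -
  define x where "x = real g * t"
  have args: "2 * (k * t - t) = 2 * j * x" "2 * j * x + x = (2 * j + 1) * x"
    "2 * real g * t = 2 * x"
    by (simp_all add: assms x_def algebra_simps)
  have p1: "2 * (sin (2 * j * x) * cos x) = sin ((2 * j + 1) * x) + sin ((2 * j - 1) * x)"
    using sin_add[of "2 * j * x" x] sin_diff[of "2 * j * x" x] by (simp add: algebra_simps)
  have p2: "2 * (sin ((2 * j + 1) * x) * cos x) = sin ((j + 1) * (2 * x)) + sin (j * (2 * x))"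
    using sin_add[of "(2 * j + 1) * x" x] sin_diff[of "(2 * j + 1) * x" x]
    by (simp add: algebra_simps)
  \<comment> \<open>Eliminating \<open>P\<close> and \<open>Q\<close> leaves a polynomial identity
    in which \<open>A\<close>, \<open>B\<close> and \<open>C\<close> act as unknowns.\<close>
  define A B C P Q where ABC: "A = sin (2 * j * x)" "B = sin ((2 * j + 1) * x)" "C = cos x"
    "P = sin ((2 * j - 1) * x)" "Q = sin ((j + 1) * (2 * x))"
  have p1': "P = 2 * (A * C) - B" and p2': "Q = 2 * (B * C) - A"
    using p1 p2 by (simp_all add: ABC mult.left_commute mult.commute)
  have A': "sin (j * (2 * x)) = A" by (simp add: ABC mult.left_commute mult.commute)
  show ?thesis
    unfolding bvp_rhs_def even_part_def odd_part_def args x_def[symmetric] A' ABC[symmetric] p1' p2'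
    by (simp add: field_simps)
qed

text \<open>Uniqueness of derivatives forces \<open>r'\<close> and \<open>r''\<close> to be
  \<open>k\<close> and \<open>0\<close> on the interval, and both boundary limits hold
  automatically.\<close>

lemma solves_bvp_linear_iff:
  fixes k :: int
  assumes "g > 0"
  shows "solves_bvp g m0 m1 k (\<lambda>t. of_int k * t) \<longleftrightarrow>
    (\<forall>t\<in>{0<..<pi / real g}. bvp_rhs g m0 m1 t (of_int k * t) (of_int k) 0 = 0)" (is "?L \<longleftrightarrow> ?R")
proof
  assume ?L
  then obtain r' r'' where r: "\<And>t. t \<in> {0<..<pi / real g} \<Longrightarrow>
        ((\<lambda>t. of_int k * t) has_real_derivative r' t) (at t) \<and>
        (r' has_real_derivative r'' t) (at t) \<and>
        0 = bvp_rhs g m0 m1 t (of_int k * t) (r' t) (r'' t)"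
    unfolding solves_bvp_def by blast
  have r': "r' t = of_int k" if "t \<in> {0<..<pi / real g}" for t
    using r[OF that] DERIV_unique DERIV_cmult_Id by blast
  have r'': "r'' t = 0" if t: "t \<in> {0<..<pi / real g}" for t
  proof -
    have "((\<lambda>_. of_int k) has_real_derivative r'' t) (at t)"
      by (rule has_field_derivative_transform_within_open[of r' _ _ "{0<..<pi / real g}"])
        (use r r' t in auto)
    then show ?thesis
      using DERIV_unique DERIV_const by blast
  qed
  show ?R
    using r r' r'' by force
next
  assume ?R
  then show ?L
    unfolding solves_bvp_def
    by (intro conjI exI[of _ "\<lambda>_. of_int k"] exI[of _ "\<lambda>_. 0"])
       (auto intro!: derivative_eq_intros tendsto_eq_intros)
qed

lemma DERIV_eq_0_if_eq_0_on_open: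
  fixes f f' :: "real \<Rightarrow> real"
  assumes "\<And>y. (f has_real_derivative f' y) (at y)" "open S" "\<And>y. y \<in> S \<Longrightarrow> f y = 0" "y \<in> S"
  shows "f' y = 0"
proof -
  have "((\<lambda>_. 0) has_real_derivative f' y) (at y)"
    by (rule has_field_derivative_transform_within_open[OF assms(1,2,4)]) (use assms(3) in auto)
  then show ?thesis
    using DERIV_unique DERIV_const by blast
qed

text \<open>The third derivative at \<open>0\<close> is the first informative one: even derivatives
  of this odd function vanish there, and the first only gives \<open>k = j * g + 1\<close>.\<close>

lemma even_part_eq_0_imp:
  assumes b: "b > 0" and e: "\<And>y. y \<in> {0<..<b} \<Longrightarrow> even_part g k j y = 0"
  shows "k = (g - 1) * j ^ 3 + (j + 1) ^ 3"
proof -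
  define f1 f2 f3 where
    "f1 y = k * cos y - (g - 1) * (j * cos (j * y)) - (j + 1) * cos ((j + 1) * y)" and
    "f2 y = - k * sin y + (g - 1) * (j ^ 2 * sin (j * y)) + (j + 1) ^ 2 * sin ((j + 1) * y)" and
    "f3 y = - k * cos y + (g - 1) * (j ^ 3 * cos (j * y)) + (j + 1) ^ 3 * cos ((j + 1) * y)"
  for y
  have d1: "(even_part g k j has_real_derivative f1 y) (at y)" for y
    unfolding even_part_def[abs_def] f1_def by (auto intro!: derivative_eq_intros)
  have d2: "(f1 has_real_derivative f2 y) (at y)" for y
    unfolding f1_def[abs_def] f2_def
    by (auto intro!: derivative_eq_intros simp: power2_eq_square)
  have d3: "(f2 has_real_derivative f3 y) (at y)" for y
    unfolding f2_def[abs_def] f3_def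
    by (auto intro!: derivative_eq_intros simp: power2_eq_square power3_eq_cube)
  have z1: "f1 y = 0" if "y \<in> {0<..<b}" for y
    by (rule DERIV_eq_0_if_eq_0_on_open[OF d1 _ e that]) auto
  have z2: "f2 y = 0" if "y \<in> {0<..<b}" for y
    by (rule DERIV_eq_0_if_eq_0_on_open[OF d2 _ z1 that]) auto
  have z3: "f3 y = 0" if "y \<in> {0<..<b}" for y
    by (rule DERIV_eq_0_if_eq_0_on_open[OF d3 _ z2 that]) auto
  \<comment> \<open>\<open>0\<close> is only an endpoint of the interval, so the value there comes
    from the limit from the right.\<close>
  have "isCont f3 0"
    unfolding f3_def[abs_def] by (intro continuous_intros)
  then have "(f3 \<longlongrightarrow> f3 0) (at_right 0)"
    by (simp add: isCont_def filterlim_at_split)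
  moreover have "eventually (\<lambda>y. f3 y = 0) (at_right 0)"
    using b z3 by (auto simp: eventually_at_right_field)
  then have "(f3 \<longlongrightarrow> 0) (at_right 0)"
    by (rule tendsto_eventually)
  ultimately have "f3 0 = 0"
    using tendsto_unique trivial_limit_at_right_real by blast
  then show ?thesis
    by (simp add: f3_def)
qed

lemma sin_of_int_mult_pi_minus:
  "sin (of_int n * (pi - x)) = - cos (of_int n * pi) * sin (of_int n * x)"
  by (simp add: sin_diff right_diff_distrib mult.commute[of _ pi])

lemma even_part_reflect:
  "even_part g k (of_int j) (2 * (pi - x)) = - even_part g k (of_int j) (2 * x)"
proof -
  have "sin (of_int n * (2 * (pi - x))) = - sin (of_int n * (2 * x))" for n :: int
    using sin_of_int_mult_pi_minus[of "2 * n" x] cos_int_2pin[of n]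
    by (simp add: mult_ac right_diff_distrib)
  from this[of 1] this[of j] this[of "j + 1"] show ?thesis
    by (simp add: even_part_def)
qed

text \<open>Odd multiples of \<open>pi\<close> have cosine \<open>-1\<close>, so the sign that flips
  for even frequencies is kept here.\<close>

lemma odd_part_reflect: "odd_part g k (of_int j) (pi - x) = odd_part g k (of_int j) x"
proof -
  have "sin ((2 * of_int j + 1) * (pi - x)) = sin ((2 * of_int j + 1) * x)" for j :: int
    using sin_of_int_mult_pi_minus[of "2 * j + 1" x] cos_int_2pin[of j]
    by (simp add: algebra_simps)
  from this[of j] this[of "j - 1"] show ?thesis
    by (simp add: odd_part_def right_diff_distrib)
qed

lemma even_part_pi: "even_part g k (of_int j) pi = 0"
  using sin_npi_int[of "j + 1"] by (simp add: even_part_def mult.commute)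

text \<open>The two shifted sines are \<open>cos (pi * j)\<close> and its negative, so
  \<open>g\<close> cancels from the coefficients.\<close>

lemma odd_part_pi_half:
  "odd_part g k (of_int j) (pi / 2) = 2 * (k - cos (pi * of_int j))"
proof -
  have "(2 * of_int j + 1) * (pi / 2) = pi * of_int j + pi / 2"
    "(2 * of_int j - 1) * (pi / 2) = pi * of_int j - pi / 2"
    by (simp_all add: field_simps)
  then show ?thesis
    unfolding odd_part_def by (simp only: sin_add sin_diff) (simp add: field_simps)
qed

text \<open>The difference of the two sides factors as
  \<open>j * (j + 1) * (g * (j - 1) + 3)\<close>; the last factor makes \<open>1 - j\<close> a
  positive divisor of 3.\<close>

lemma cubic_solutions:
  fixes g j :: int
  assumes "g > 0" and "j * g + 1 = (g - 1) * j ^ 3 + (j + 1) ^ 3"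
  shows "j = 0 \<or> j = -1 \<or> (g = 1 \<and> j = -2)"
proof -
  have "j * (j + 1) * (g * (j - 1) + 3) = 0"
    using assms(2) by algebra
  then have "j = 0 \<or> j + 1 = 0 \<or> g * (j - 1) + 3 = 0"
    by (simp only: mult_eq_0_iff disj_assoc)
  then have "j = 0 \<or> j = -1 \<or> g * (1 - j) = 3"
    unfolding right_diff_distrib by linarith
  then consider "j = 0" | "j = -1" | "g * (1 - j) = 3"
    by blast
  then show ?thesis
  proof cases
    case 3
    then have "1 - j > 0"
      using \<open>g > 0\<close> zero_less_mult_pos[of g "1 - j"] by simp
    moreover have "1 - j \<le> 3"
      using 3 \<open>g > 0\<close> calculation mult_right_mono[of 1 g "1 - j"] by simp
    ultimately have "j = 0 \<or> j = -1 \<or> j = -2"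
      by arith
    then show ?thesis
      using 3 by auto
  qed auto
qed

theorem lemmaG:
  fixes g m0 m1 :: nat and j k :: int
  assumes "g > 0" and "m0 > 0" and "m1 > 0"
    and "k = j * int g + 1"
    and "\<not> (g = 1 \<and> m0 = m1 \<and> k = - 1)"
  shows "solves_bvp g m0 m1 k (\<lambda>t. of_int k * t) \<longleftrightarrow>
    k = 1 \<or> (g = 2 \<and> k = - 1) \<or> (m0 = m1 \<and> k = 1 - int g)"
proof -
  let ?s = "real m0 + real m1" and ?d = "real m0 - real m1"
  let ?E = "even_part (real g) (of_int k) (of_int j)"
  let ?O = "odd_part (real g) (of_int k) (of_int j)"
  have k: "real_of_int k = of_int j * real g + 1"
    using assms(4) by simp
  have iff: "solves_bvp g m0 m1 k (\<lambda>t. of_int k * t) \<longleftrightarrow>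
      (\<forall>x\<in>{0<..<pi}. ?s * ?E (2 * x) + ?d * ?O x = 0)" (is "_ \<longleftrightarrow> ?R")
  proof -
    have "(\<forall>t\<in>{0<..<pi / real g}. ?s * ?E (2 * (real g * t)) + ?d * ?O (real g * t) = 0) \<longleftrightarrow> ?R"
    proof (intro iffI ballI)
      fix x
      assume "\<forall>t\<in>{0<..<pi / real g}. ?s * ?E (2 * (real g * t)) + ?d * ?O (real g * t) = 0"
        and "x \<in> {0<..<pi}"
      then show "?s * ?E (2 * x) + ?d * ?O x = 0"
        using assms(1) by (auto dest!: bspec[of _ _ "x / real g"] simp: divide_strict_right_mono)
    next
      fix t
      assume ?R and "t \<in> {0<..<pi / real g}"
      then show "?s * ?E (2 * (real g * t)) + ?d * ?O (real g * t) = 0"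
        using assms(1) by (auto dest!: bspec[of _ _ "real g * t"] simp: field_simps)
    qed
    then show ?thesis
      using assms(1) unfolding solves_bvp_linear_iff[OF assms(1)] bvp_rhs_linear[OF k] by simp
  qed
  show ?thesis
    unfolding iff
  proof
    assume R: ?R
    have E: "?E y = 0" if "y \<in> {0<..<2 * pi}" for y
    proof -
      \<comment> \<open>Subtracting the equations at \<open>y / 2\<close> and its reflection cancels
        the odd part.\<close>
      have "?s * ?E y + ?d * ?O (y / 2) = 0" "- ?s * ?E y + ?d * ?O (y / 2) = 0"
        using bspec[OF R, of "y / 2"] bspec[OF R, of "pi - y / 2"] that
        by (simp_all only: even_part_reflect odd_part_reflect) auto
      then have "?s * ?E y = 0"
        unfolding mult_minus_left by linarith
      then show ?thesis
        using assms(2) by simp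
    qed
    have "real_of_int k = (real g - 1) * of_int j ^ 3 + (of_int j + 1) ^ 3"
      by (rule even_part_eq_0_imp[OF _ E]) auto
    then have "real_of_int (j * int g + 1) = real_of_int ((int g - 1) * j ^ 3 + (j + 1) ^ 3)"
      using assms(4) by simp
    then have "j * int g + 1 = (int g - 1) * j ^ 3 + (j + 1) ^ 3"
      by (simp only: of_int_eq_iff)
    then have cases: "j = 0 \<or> j = -1 \<or> (g = 1 \<and> j = -2)"
      using cubic_solutions[of "int g" j] assms(1) by simp
    have "?d * (of_int k - cos (pi * of_int j)) = 0"
      using bspec[OF R, of "pi / 2"] by (simp add: even_part_pi odd_part_pi_half)
    then have "m0 = m1 \<or> of_int k = cos (pi * of_int j)"
      by simp
    \<comment> \<open>For \<open>j = -1\<close>, \<open>k = 1 - g\<close>, and if \<open>m0\<close>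
      and \<open>m1\<close> differ then \<open>k = cos (- pi) = -1\<close>, so \<open>g = 2\<close>.
      For \<open>g = 1\<close>, \<open>j = -2\<close>, \<open>k = -1\<close>: equal
      \<open>m0\<close>, \<open>m1\<close> are excluded by hypothesis, and otherwise
      \<open>k\<close> would be \<open>1\<close>.\<close>
    then show "k = 1 \<or> (g = 2 \<and> k = - 1) \<or> (m0 = m1 \<and> k = 1 - int g)"
      using cases assms(4,5) by (auto simp: mult.commute[of pi])
  next
    assume rhs: "k = 1 \<or> (g = 2 \<and> k = - 1) \<or> (m0 = m1 \<and> k = 1 - int g)"
    have "j = 0" if "k = 1"
      using that assms(1,4) by simp
    moreover have "j = -1" if "g = 2" "k = - 1"
      using that assms(4) by simp
    moreover have "j = -1" if "k = 1 - int g"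
    proof -
      have "(j + 1) * int g = 0"
        using that assms(4) by (simp add: distrib_right)
      then show ?thesis
        using assms(1) by simp
    qed
    ultimately consider "j = 0" | "j = -1" "g = 2" | "j = -1" "m0 = m1"
      using rhs by blast
    then show ?R
    proof cases
      \<comment> \<open>Both parts vanish in the first two cases; in the third only the even part
        need vanish, since \<open>m0 - m1 = 0\<close>.\<close>
      case 1
      then show ?thesis
        by (auto simp: k even_part_def odd_part_def field_simps)
    next
      case 2
      then show ?thesis
        by (auto simp: k even_part_def odd_part_def)
    next
      case 3
      then show ?thesis
        by (auto simp: k even_part_def algebra_simps)
    qed
  qed
qed

end
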